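(* The following are equivalent for a commutative ring $R$ with identity: (1) every weakly IN $R$-module is strongly CS; (2) $R/\mathfrak{m}\oplus R/\mathfrak{m}'$ is a strongly CS $R$-module for every two distinct maximal ideals $\mathfrak{m}$ and $\mathfrak{m}'$ of $R$; (3) idempotents of $R$ lift modulo $\mathfrak{m}\cap\mathfrak{m}'$ for every two distinct maximal ideals $\mathfrak{m}$ and $\mathfrak{m}'$ of $R$; (4) idempotents lift modulo every ideal of $R$; (5) for every two distinct maximal ideals $\mathfrak{m}$ and $\mathfrak{m}'$ of $R$, there exists an idempotent $e$ of $R$ such that $e\in\mathfrak{m}$ and $1-e\in\mathfrak{m}'$; (6) $R$ is a clean ring.
   Context: All rings are commutative with identity and all modules are unital. For an $R$-module $N$, $\mathrm{Ann}_R(N)=\{r\in R\mid rN=0\}$. An $R$-module $M$ is weakly IN if $\mathrm{Ann}_R(N)+\mathrm{Ann}_R(L)=R$ for all submodules $N,L$ of $M$ with $N\cap L=0$. $M$ is strongly CS if for every submodule $N$ of $M$ there exists an idempotent $e=e^2\in R$ such that $N$ is an essential submodule of $eM$. For a (proper) ideal $I$ of $R$, idempotents lift modulo $I$ if whenever $r\in R$ satisfies $r-r^2\in I$, there exists $e=e^2\in R$ with $r-e\in I$. A ring is clean if every element is a sum of a unit and an idempotent. *)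

theory Defs
  imports "HOL-Algebra.Module" "HOL-Algebra.QuotRing"
begin

definition idem_elem :: "('a, 'r) ring_scheme \<Rightarrow> 'a \<Rightarrow> bool" where
  "idem_elem R e \<longleftrightarrow> e \<in> carrier R \<and> e \<otimes>\<^bsub>R\<^esub> e = e"

definition clean_ring :: "('a, 'r) ring_scheme \<Rightarrow> bool" where
  "clean_ring R \<longleftrightarrow>
    (\<forall>r\<in>carrier R. \<exists>u\<in>Units R. \<exists>e. idem_elem R e \<and> r = u \<oplus>\<^bsub>R\<^esub> e)"

definition idempotents_lift_modulo :: "('a, 'r) ring_scheme \<Rightarrow> 'a set \<Rightarrow> bool" where
  "idempotents_lift_modulo R I \<longleftrightarrow>
    (\<forall>r\<in>carrier R. r \<ominus>\<^bsub>R\<^esub> (r \<otimes>\<^bsub>R\<^esub> r) \<in> I \<longrightarrow>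
      (\<exists>e. idem_elem R e \<and> r \<ominus>\<^bsub>R\<^esub> e \<in> I))"

definition module_ann :: "('a, 'r) ring_scheme \<Rightarrow> ('a, 'b, 'm) module_scheme \<Rightarrow> 'b set \<Rightarrow> 'a set" where
  "module_ann R M N = {r \<in> carrier R. \<forall>x\<in>N. r \<odot>\<^bsub>M\<^esub> x = \<zero>\<^bsub>M\<^esub>}"

definition weakly_IN :: "('a, 'r) ring_scheme \<Rightarrow> ('a, 'b, 'm) module_scheme \<Rightarrow> bool" where
  "weakly_IN R M \<longleftrightarrow>
    (\<forall>N L. submodule N R M \<and> submodule L R M \<and> N \<inter> L = {\<zero>\<^bsub>M\<^esub>} \<longrightarrow>
      module_ann R M N <+>\<^bsub>R\<^esub> module_ann R M L = carrier R)"

text \<open>\<open>N\<close> is an essential submodule of the submodule \<open>K\<close> of \<open>M\<close>; the submodules of \<open>K\<close> are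
  the submodules of \<open>M\<close> that are contained in \<open>K\<close>.\<close>

definition essential_submodule ::
  "('a, 'r) ring_scheme \<Rightarrow> ('a, 'b, 'm) module_scheme \<Rightarrow> 'b set \<Rightarrow> 'b set \<Rightarrow> bool" where
  "essential_submodule R M N K \<longleftrightarrow>
    submodule N R M \<and> submodule K R M \<and> N \<subseteq> K \<and>
    (\<forall>L. submodule L R M \<and> L \<subseteq> K \<and> N \<inter> L = {\<zero>\<^bsub>M\<^esub>} \<longrightarrow> L = {\<zero>\<^bsub>M\<^esub>})"

definition strongly_CS :: "('a, 'r) ring_scheme \<Rightarrow> ('a, 'b, 'm) module_scheme \<Rightarrow> bool" where
  "strongly_CS R M \<longleftrightarrow>
    (\<forall>N. submodule N R M \<longrightarrow>
      (\<exists>e. idem_elem R e \<and> essential_submodule R M N ((\<lambda>x. e \<odot>\<^bsub>M\<^esub> x) ` carrier M)))"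

text \<open>The record type of modules extends that of rings; the fields \<open>mult\<close> and \<open>one\<close> play no
  role in the module structure.\<close>

definition quotient_module :: "('a, 'r) ring_scheme \<Rightarrow> 'a set \<Rightarrow> ('a, 'a set) module" where
  "quotient_module R I =
    \<lparr>carrier = carrier (R Quot I), monoid.mult = monoid.mult (R Quot I), one = one (R Quot I),
     zero = zero (R Quot I), add = add (R Quot I),
     smult = (\<lambda>r x. (I +>\<^bsub>R\<^esub> r) \<otimes>\<^bsub>(R Quot I)\<^esub> x)\<rparr>"

definition module_direct_sum ::
  "('a, 'b, 'm) module_scheme \<Rightarrow> ('a, 'c, 'n) module_scheme \<Rightarrow> ('a, 'b \<times> 'c) module" where
  "module_direct_sum M N =
    \<lparr>carrier = carrier M \<times> carrier N,
     monoid.mult = (\<lambda>(x, y) (x', y'). (x \<otimes>\<^bsub>M\<^esub> x', y \<otimes>\<^bsub>N\<^esub> y')), one = (\<one>\<^bsub>M\<^esub>, \<one>\<^bsub>N\<^esub>),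
     zero = (\<zero>\<^bsub>M\<^esub>, \<zero>\<^bsub>N\<^esub>),
     add = (\<lambda>(x, y) (x', y'). (x \<oplus>\<^bsub>M\<^esub> x', y \<oplus>\<^bsub>N\<^esub> y')),
     smult = (\<lambda>r (x, y). (r \<odot>\<^bsub>M\<^esub> x, r \<odot>\<^bsub>N\<^esub> y))\<rparr>"

lemma quotient_module_is_module:
  assumes "cring R" "ideal I R"
  shows "module R (quotient_module R I)"
proof -
  interpret cring R by fact
  interpret I: ideal I R by fact
  interpret Q: ring "R Quot I" by (rule I.quotient_is_ring)
  interpret h: ring_hom_ring R "R Quot I" "(+>\<^bsub>R\<^esub>) I" by (rule I.rcos_ring_hom_ring)
  have "abelian_group (quotient_module R I)"
    by (rule abelian_groupI)
      (auto simp: quotient_module_def Q.a_ac intro!: bexI[of _ "\<ominus>\<^bsub>(R Quot I)\<^esub> _"] Q.l_neg)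
  then show ?thesis
    by (rule moduleI[OF assms(1)])
      (auto simp: quotient_module_def Q.l_distr Q.r_distr Q.m_assoc)
qed

lemma module_direct_sum_is_module:
  assumes "module R M" "module R N"
  shows "module R (module_direct_sum M N)"
proof -
  interpret M: module R M by fact
  interpret N: module R N by fact
  have "abelian_group (module_direct_sum M N)"
    by (rule abelian_groupI)
      (auto simp: module_direct_sum_def M.a_ac N.a_ac
        intro!: M.l_neg N.l_neg bexI[of _ "\<ominus>\<^bsub>M\<^esub> _"] bexI[of _ "\<ominus>\<^bsub>N\<^esub> _"])
  then show ?thesis
    by (rule moduleI[OF M.R.is_cring])
      (auto simp: module_direct_sum_def M.smult_l_distr N.smult_l_distr
        M.smult_r_distr N.smult_r_distr M.smult_assoc1 N.smult_assoc1)
qed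

end

theory Submission
  imports "HOL-Algebra.Ring_Divisibility" Defs
begin

text \<open>
All six conditions are ways of saying that idempotents separate the points of the maximal spectrum
of \<open>R\<close>, and they meet in the exchange property: for every \<open>r\<close> there is an idempotent \<open>g\<close> with
\<open>g \<in> R(r - 1)\<close> and \<open>1 - g \<in> Rr\<close>. An idempotent cuts out a clopen set, and the maximal spectrum is
compact, so separating points is the same as separating the disjoint closed sets \<open>V(r)\<close> and
\<open>V(r - 1)\<close>; this is \<open>exchange_ring_if_idempotents_separate\<close>, whose topological content is the
algebraic lemma \<open>idempotent_compactness\<close>. In a commutative ring the exchange property is a
rearrangement of cleanness (\<open>clean_ring_iff_exchange_ring\<close>).

The exchange property lifts idempotents modulo every ideal. Conversely, lifting modulo
\<open>m \<inter> m'\<close> the idempotent that is \<open>0\<close> modulo \<open>m\<close> and \<open>1\<close> modulo \<open>m'\<close> separates the two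
maximal ideals.

For modules, let \<open>N\<close> be a submodule and \<open>L\<close> a maximal submodule with \<open>N \<inter> L = 0\<close>. The weak IN
condition writes \<open>1\<close> as a sum of an element that kills \<open>N\<close> and one that kills \<open>L\<close>; the exchange
property turns this into an idempotent \<open>g\<close> that fixes \<open>N\<close> and kills \<open>L\<close>, and maximality of \<open>L\<close>
makes \<open>N\<close> essential in \<open>gM\<close> (\<open>exchange_ring_weakly_IN_imp_strongly_CS\<close>). The circle is closed
by the test modules \<open>R/m \<oplus> R/m'\<close>: they are always weakly IN, and when such a module is strongly
CS, the idempotent belonging to its first summand separates \<open>m\<close> and \<open>m'\<close>.\<close>

section \<open>Idempotents, maximal ideals and the exchange property\<close>

text \<open>This is the ring-theoretic pivot of the equivalences: the exchange (suitable) property of Nicholson.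
In terms of the spectrum, \<open>g\<close> cuts out a clopen set separating the disjoint closed sets \<open>V(r)\<close> and
\<open>V(r - 1)\<close>: the condition forces \<open>g \<in> m\<close> at maximal ideals \<open>m\<close> containing \<open>r - 1\<close>, and
\<open>1 - g \<in> m\<close> at those containing \<open>r\<close>.\<close>

definition exchange_ring :: "('a, 'r) ring_scheme \<Rightarrow> bool" where
  "exchange_ring R \<longleftrightarrow>
    (\<forall>r\<in>carrier R. \<exists>g. idem_elem R g \<and>
      g \<in> PIdl\<^bsub>R\<^esub> (r \<ominus>\<^bsub>R\<^esub> \<one>\<^bsub>R\<^esub>) \<and> \<one>\<^bsub>R\<^esub> \<ominus>\<^bsub>R\<^esub> g \<in> PIdl\<^bsub>R\<^esub> r)"

lemma (in cring) exists_maximalideal_containing: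
  assumes I: "ideal I R" and proper: "\<one> \<notin> I"
  obtains m where "maximalideal m R" "I \<subseteq> m"
proof -
  let ?A = "{J. ideal J R \<and> I \<subseteq> J \<and> \<one> \<notin> J}"
  have "\<exists>m\<in>?A. \<forall>J\<in>?A. m \<subseteq> J \<longrightarrow> J = m"
  proof (rule subset_Zorn_nonempty)
    show "?A \<noteq> {}" using I proper by blast
    fix C assume C: "C \<noteq> {}" "subset.chain ?A C"
    have sub: "C \<subseteq> ?A" using C(2) unfolding pred_on.chain_def by blast
    then have "subset.chain {J. ideal J R} C"
      using C(2) unfolding pred_on.chain_def by blast
    from chain_Union_is_ideal[OF this] C(1) have "ideal (\<Union>C) R" by simp
    then show "\<Union>C \<in> ?A" using sub C(1) by blast
  qed
  then obtain m where mA: "m \<in> ?A" and max: "\<forall>J\<in>?A. m \<subseteq> J \<longrightarrow> J = m" by (rule bexE)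
  from mA have m: "ideal m R" "I \<subseteq> m" "\<one> \<notin> m" by simp_all
  have "maximalideal m R"
  proof (rule maximalidealI)
    show "ideal m R" "carrier R \<noteq> m" using m by auto
    fix J assume J: "ideal J R" "m \<subseteq> J" "J \<subseteq> carrier R"
    show "J = m \<or> J = carrier R"
    proof (cases "\<one> \<in> J")
      case True
      then show ?thesis using ideal.one_imp_carrier[OF J(1)] by simp
    next
      case False
      then have "J \<in> ?A" using J(1,2) m(2) by simp
      then show ?thesis using max J(2) by simp
    qed
  qed
  then show thesis using m(2) that by blast
qed

lemma (in cring) idem_elem_compl:
  assumes "idem_elem R e"
  shows "idem_elem R (\<one> \<ominus> e)"
proof -
  have e: "e \<in> carrier R" "e \<otimes> e = e" using assms by (auto simp: idem_elem_def)
  have "(\<one> \<ominus> e) \<otimes> (\<one> \<ominus> e) = \<one> \<ominus> e \<ominus> e \<oplus> e \<otimes> e" using e(1) by algebra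
  also have "\<dots> = \<one> \<ominus> e" using e by algebra
  finally show ?thesis using e by (simp add: idem_elem_def)
qed

lemma (in cring) idem_elem_mult:
  assumes "idem_elem R e" "idem_elem R f"
  shows "idem_elem R (e \<otimes> f)"
proof -
  have c: "e \<in> carrier R" "f \<in> carrier R" and idem: "e \<otimes> e = e" "f \<otimes> f = f"
    using assms by (auto simp: idem_elem_def)
  have "(e \<otimes> f) \<otimes> (e \<otimes> f) = (e \<otimes> e) \<otimes> (f \<otimes> f)" using c by algebra
  then show ?thesis using c idem by (simp add: idem_elem_def)
qed

text \<open>The join of two idempotents in the Boolean algebra of idempotents is the complement of the product
of their complements.\<close>

lemma (in cring) idem_elem_join:
  assumes "idem_elem R f" "idem_elem R g"
  shows "idem_elem R (f \<oplus> g \<ominus> f \<otimes> g)"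
proof -
  have c: "f \<in> carrier R" "g \<in> carrier R" using assms by (auto simp: idem_elem_def)
  have "f \<oplus> g \<ominus> f \<otimes> g = \<one> \<ominus> (\<one> \<ominus> f) \<otimes> (\<one> \<ominus> g)" using c by algebra
  then show ?thesis using assms by (simp add: idem_elem_compl idem_elem_mult)
qed

lemma (in ideal) join_closed:
  assumes "f \<in> I" "g \<in> I"
  shows "f \<oplus> g \<ominus> f \<otimes> g \<in> I"
  using assms by (simp add: a_minus_def I_l_closed)

text \<open>The ideal is prime and proper, while \<open>e (1 - e) = 0\<close> and \<open>e + (1 - e) = 1\<close>.\<close>

lemma (in cring) idem_elem_mem_maximalideal:
  assumes m: "maximalideal m R" and e: "idem_elem R e"
  shows "e \<in> m \<longleftrightarrow> \<one> \<ominus> e \<notin> m"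
proof -
  interpret m: maximalideal m R by fact
  interpret p: primeideal m R using maximalideal_prime[OF m] .
  have c: "e \<in> carrier R" "e \<otimes> e = e" using e by (auto simp: idem_elem_def)
  have "e \<otimes> (\<one> \<ominus> e) = e \<ominus> e \<otimes> e" using c(1) by algebra
  also have "\<dots> = \<zero>" using c by algebra
  finally have "e \<in> m \<or> \<one> \<ominus> e \<in> m" using p.I_prime[of e "\<one> \<ominus> e"] c by simp
  moreover have False if "e \<in> m" "\<one> \<ominus> e \<in> m"
  proof -
    have "e \<oplus> (\<one> \<ominus> e) \<in> m" using that by simp
    moreover have "e \<oplus> (\<one> \<ominus> e) = \<one>" using c(1) by algebra
    ultimately show False using m.one_imp_carrier m.I_notcarr by simp
  qed
  ultimately show ?thesis by blast
qed

text \<open>This is compactness of the maximal spectrum, in the form needed here. Each \<open>f \<in> F\<close> cuts out the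
clopen set of maximal ideals that omit \<open>f\<close>; these sets cover \<open>V(I)\<close>, and because \<open>F\<close> is closed
under joins a finite subcover can be replaced by one member. Algebraically, the elements \<open>x\<close> with
\<open>(1 - f) x \<in> I\<close> for some \<open>f \<in> F\<close> form an ideal \<open>J\<close>. It contains \<open>I\<close> and \<open>F\<close>, so no maximal
ideal contains it, hence \<open>1 \<in> J\<close>.\<close>

lemma (in cring) idempotent_compactness:
  assumes I: "ideal I R"
    and idem: "\<And>f. f \<in> F \<Longrightarrow> idem_elem R f"
    and zero: "\<zero> \<in> F"
    and join: "\<And>f g. f \<in> F \<Longrightarrow> g \<in> F \<Longrightarrow> f \<oplus> g \<ominus> f \<otimes> g \<in> F"
    and avoid: "\<And>m. maximalideal m R \<Longrightarrow> I \<subseteq> m \<Longrightarrow> \<exists>f\<in>F. f \<notin> m"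
  shows "\<exists>f\<in>F. \<one> \<ominus> f \<in> I"
proof -
  interpret I: ideal I R by fact
  have Fc: "f \<in> carrier R" "f \<otimes> f = f" if "f \<in> F" for f
    using idem[OF that] by (auto simp: idem_elem_def)
  define J where "J = {x \<in> carrier R. \<exists>f\<in>F. (\<one> \<ominus> f) \<otimes> x \<in> I}"
  have J: "ideal J R"
  proof (rule idealI)
    show "ring R" by (rule ring_axioms)
    show "subgroup J (add_monoid R)"
    proof (rule add.subgroupI)
      show "J \<subseteq> carrier R" by (auto simp: J_def)
      show "J \<noteq> {}" using zero by (auto simp: J_def intro!: exI[of _ \<zero>] bexI[of _ \<zero>])
    next
      fix x assume "x \<in> J"
      then obtain f where f: "x \<in> carrier R" "f \<in> F" "(\<one> \<ominus> f) \<otimes> x \<in> I"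
        by (auto simp: J_def)
      have "(\<one> \<ominus> f) \<otimes> (\<ominus> x) = \<ominus> ((\<one> \<ominus> f) \<otimes> x)" using f(1) Fc[OF f(2)] by algebra
      also have "\<dots> \<in> I" using f by simp
      finally show "\<ominus> x \<in> J" using f by (auto simp: J_def)
    next
      fix x y assume "x \<in> J" "y \<in> J"
      then obtain f g where f: "x \<in> carrier R" "f \<in> F" "(\<one> \<ominus> f) \<otimes> x \<in> I"
        and g: "y \<in> carrier R" "g \<in> F" "(\<one> \<ominus> g) \<otimes> y \<in> I"
        by (auto simp: J_def)
      \<comment> \<open>The complement of the join is the product of the complements, so the join serves both summands.\<close>
      have "(\<one> \<ominus> (f \<oplus> g \<ominus> f \<otimes> g)) \<otimes> (x \<oplus> y)
          = (\<one> \<ominus> g) \<otimes> ((\<one> \<ominus> f) \<otimes> x) \<oplus> (\<one> \<ominus> f) \<otimes> ((\<one> \<ominus> g) \<otimes> y)"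
        using f(1) g(1) Fc(1)[OF f(2)] Fc(1)[OF g(2)] by algebra
      also have "\<dots> \<in> I"
        using f g Fc(1)[OF f(2)] Fc(1)[OF g(2)] by (simp add: I.I_l_closed)
      finally show "x \<oplus> y \<in> J" using join[OF f(2) g(2)] f(1) g(1) by (auto simp: J_def)
    qed
    fix a x assume "a \<in> J" and x: "x \<in> carrier R"
    then obtain f where f: "a \<in> carrier R" "f \<in> F" "(\<one> \<ominus> f) \<otimes> a \<in> I"
      by (auto simp: J_def)
    have "(\<one> \<ominus> f) \<otimes> (x \<otimes> a) = x \<otimes> ((\<one> \<ominus> f) \<otimes> a)"
      using f(1) Fc(1)[OF f(2)] x by algebra
    also have "\<dots> \<in> I" using f x by (simp add: I.I_l_closed)
    finally show "x \<otimes> a \<in> J" using f x by (auto simp: J_def)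
    then show "a \<otimes> x \<in> J" using f x by (simp add: m_comm)
  qed
  have IJ: "I \<subseteq> J"
  proof
    fix x assume x: "x \<in> I"
    then have "x \<in> carrier R" by (rule I.Icarr)
    then have "(\<one> \<ominus> \<zero>) \<otimes> x = x" by algebra
    then have "(\<one> \<ominus> \<zero>) \<otimes> x \<in> I" using x by simp
    then show "x \<in> J" using zero \<open>x \<in> carrier R\<close> by (auto simp: J_def)
  qed
  have FJ: "F \<subseteq> J"
  proof
    fix f assume f: "f \<in> F"
    have "(\<one> \<ominus> f) \<otimes> f = f \<ominus> f \<otimes> f" using Fc(1)[OF f] by algebra
    also have "\<dots> = \<zero>" using Fc[OF f] by algebra
    finally have "(\<one> \<ominus> f) \<otimes> f \<in> I" by simp
    then show "f \<in> J" using f Fc[OF f] by (auto simp: J_def)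
  qed
  have "\<one> \<in> J"
  proof (rule ccontr)
    assume "\<one> \<notin> J"
    then obtain m where "maximalideal m R" "J \<subseteq> m"
      using exists_maximalideal_containing[OF J] by blast
    then show False using avoid IJ FJ by blast
  qed
  then show ?thesis using Fc by (auto simp: J_def)
qed

text \<open>The usual passage from separating points to separating disjoint closed sets in a compact space: the
compactness lemma is applied twice. The inner application fixes a maximal ideal \<open>m\<close> containing \<open>r\<close>
and varies the one containing \<open>r - 1\<close>; the outer one varies \<open>m\<close>.\<close>

lemma (in cring) exchange_ring_if_idempotents_separate:
  assumes sep: "\<And>m m'. maximalideal m R \<Longrightarrow> maximalideal m' R \<Longrightarrow> m \<noteq> m' \<Longrightarrow>
      \<exists>e. idem_elem R e \<and> e \<in> m \<and> \<one> \<ominus> e \<in> m'"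
  shows "exchange_ring R"
  unfolding exchange_ring_def
proof
  fix r assume r: "r \<in> carrier R"
  let ?A = "PIdl (r \<ominus> \<one>)" and ?B = "PIdl r"
  interpret A: ideal ?A R using r by (simp add: cgenideal_ideal)
  interpret B: ideal ?B R using r by (simp add: cgenideal_ideal)
  have zero: "idem_elem R \<zero>" by (simp add: idem_elem_def)
  have "\<exists>g\<in>{g \<in> ?A. idem_elem R g}. \<one> \<ominus> g \<in> ?B"
  proof (rule idempotent_compactness)
    show "ideal ?B R" by (rule B.is_ideal)
    fix m assume m: "maximalideal m R" "?B \<subseteq> m"
    interpret m: maximalideal m R by fact
    have rm: "r \<in> m" using m(2) cgenideal_self[OF r] by blast
    have "\<exists>f\<in>{f \<in> m. idem_elem R f}. \<one> \<ominus> f \<in> ?A"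
    proof (rule idempotent_compactness)
      show "ideal ?A R" by (rule A.is_ideal)
      fix m' assume m': "maximalideal m' R" "?A \<subseteq> m'"
      interpret m': maximalideal m' R by fact
      have rm': "r \<ominus> \<one> \<in> m'" using m'(2) cgenideal_self[of "r \<ominus> \<one>"] r by auto
      have "m \<noteq> m'"
      proof
        assume "m = m'"
        then have "r \<ominus> (r \<ominus> \<one>) \<in> m'" using rm rm' by (simp add: a_minus_def)
        moreover have "r \<ominus> (r \<ominus> \<one>) = \<one>" using r by algebra
        ultimately show False using m'.one_imp_carrier m'.I_notcarr by simp
      qed
      then show "\<exists>f\<in>{f \<in> m. idem_elem R f}. f \<notin> m'"
        using sep[OF m(1) m'(1)] idem_elem_mem_maximalideal[OF m'(1)] by blast
    qed (auto simp: zero idem_elem_join m.join_closed)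
    then obtain f where f: "f \<in> m" "idem_elem R f" "\<one> \<ominus> f \<in> ?A" by blast
    then show "\<exists>g\<in>{g \<in> ?A. idem_elem R g}. g \<notin> m"
      using idem_elem_compl idem_elem_mem_maximalideal[OF m(1)] by blast
  qed (auto simp: zero idem_elem_join A.join_closed)
  then show "\<exists>g. idem_elem R g \<and> g \<in> ?A \<and> \<one> \<ominus> g \<in> ?B" by blast
qed

text \<open>If \<open>r = u + e\<close> with \<open>u\<close> a unit, then \<open>(r - 1) e = u e\<close> and \<open>r (1 - e) = u (1 - e)\<close>, so
\<open>e\<close> itself is the idempotent that the exchange property asks for. Conversely, if \<open>g = a (r - 1)\<close>
and \<open>1 - g = b r\<close>, then \<open>r - g\<close> agrees with \<open>r - 1\<close> on the factor \<open>gR\<close> and with \<open>r\<close> on the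
factor \<open>(1 - g)R\<close>, where the inverses are \<open>a\<close> and \<open>b\<close> respectively.\<close>

lemma (in cring) clean_ring_iff_exchange_ring: "clean_ring R \<longleftrightarrow> exchange_ring R"
proof
  assume clean: "clean_ring R"
  show "exchange_ring R"
    unfolding exchange_ring_def
  proof
    fix r assume r: "r \<in> carrier R"
    then obtain u e where u: "u \<in> Units R" and e: "e \<in> carrier R" "e \<otimes> e = e"
      and re: "r = u \<oplus> e"
      using clean unfolding clean_ring_def idem_elem_def by blast
    have uc: "u \<in> carrier R" "inv u \<in> carrier R" "inv u \<otimes> u = \<one>" using u by auto
    have "e \<otimes> (r \<ominus> \<one>) = e \<otimes> u \<oplus> (e \<otimes> e \<ominus> e)"
      unfolding re using e(1) uc(1) by algebra
    also have "\<dots> = e \<otimes> u" unfolding e(2) using e(1) uc(1) by algebra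
    finally have "(inv u \<otimes> e) \<otimes> (r \<ominus> \<one>) = inv u \<otimes> (e \<otimes> u)"
      using e(1) uc(2) r by (simp add: m_assoc)
    also have "\<dots> = (inv u \<otimes> u) \<otimes> e" using e(1) uc(1,2) by algebra
    finally have 1: "e = (inv u \<otimes> e) \<otimes> (r \<ominus> \<one>)" using uc(3) e(1) by simp
    have "(\<one> \<ominus> e) \<otimes> r = (\<one> \<ominus> e) \<otimes> u \<oplus> (e \<ominus> e \<otimes> e)"
      unfolding re using e(1) uc(1) by algebra
    also have "\<dots> = (\<one> \<ominus> e) \<otimes> u" unfolding e(2) using e(1) uc(1) by algebra
    finally have "(inv u \<otimes> (\<one> \<ominus> e)) \<otimes> r = inv u \<otimes> ((\<one> \<ominus> e) \<otimes> u)"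
      using e(1) uc(2) r by (simp add: m_assoc)
    also have "\<dots> = (inv u \<otimes> u) \<otimes> (\<one> \<ominus> e)" using e(1) uc(1,2) by algebra
    finally have 2: "\<one> \<ominus> e = (inv u \<otimes> (\<one> \<ominus> e)) \<otimes> r" using uc(3) e(1) by simp
    have "e \<in> PIdl (r \<ominus> \<one>)" unfolding cgenideal_def using 1 e(1) uc(2) by blast
    moreover have "\<one> \<ominus> e \<in> PIdl r"
      unfolding cgenideal_def using 2 e(1) uc(2) m_closed minus_closed one_closed by blast
    ultimately show "\<exists>g. idem_elem R g \<and> g \<in> PIdl (r \<ominus> \<one>) \<and> \<one> \<ominus> g \<in> PIdl r"
      using e by (auto simp: idem_elem_def)
  qed
next
  assume ex: "exchange_ring R"
  show "clean_ring R"
    unfolding clean_ring_def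
  proof
    fix r assume r: "r \<in> carrier R"
    with ex obtain g where g: "idem_elem R g" "g \<in> PIdl (r \<ominus> \<one>)" "\<one> \<ominus> g \<in> PIdl r"
      unfolding exchange_ring_def by blast
    then obtain a b where a: "a \<in> carrier R" "g = a \<otimes> (r \<ominus> \<one>)"
      and b: "b \<in> carrier R" "\<one> \<ominus> g = b \<otimes> r"
      unfolding cgenideal_def by blast
    have gc: "g \<in> carrier R" "g \<otimes> g = g" using g(1) by (auto simp: idem_elem_def)
    \<comment> \<open>The inverse of \<open>r - g\<close>, glued from its inverses on the two factors.\<close>
    let ?v = "a \<otimes> g \<oplus> b \<otimes> (\<one> \<ominus> g)"
    have "g \<otimes> (r \<ominus> g) = g \<otimes> r \<ominus> g \<otimes> g" using r gc(1) by algebra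
    also have "\<dots> = g \<otimes> (r \<ominus> \<one>)" unfolding gc(2) using r gc(1) by algebra
    finally have 1: "g \<otimes> (r \<ominus> g) = g \<otimes> (r \<ominus> \<one>)" .
    have "(\<one> \<ominus> g) \<otimes> (r \<ominus> g) = (\<one> \<ominus> g) \<otimes> r \<oplus> (g \<otimes> g \<ominus> g)" using r gc(1) by algebra
    also have "\<dots> = (\<one> \<ominus> g) \<otimes> r" unfolding gc(2) using r gc(1) by algebra
    finally have 2: "(\<one> \<ominus> g) \<otimes> (r \<ominus> g) = (\<one> \<ominus> g) \<otimes> r" .
    have "?v \<otimes> (r \<ominus> g) = a \<otimes> (g \<otimes> (r \<ominus> g)) \<oplus> b \<otimes> ((\<one> \<ominus> g) \<otimes> (r \<ominus> g))"
      using r a(1) b(1) gc(1) by (simp add: l_distr m_assoc)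
    also have "\<dots> = g \<otimes> (a \<otimes> (r \<ominus> \<one>)) \<oplus> (\<one> \<ominus> g) \<otimes> (b \<otimes> r)"
      unfolding 1 2 using r a(1) b(1) gc(1) by (simp add: m_lcomm)
    also have "\<dots> = g \<oplus> (\<one> \<ominus> g)"
      using a(2) b(2) gc idem_elem_compl[OF g(1)] by (simp add: idem_elem_def)
    also have "\<dots> = \<one>" using gc(1) by algebra
    finally have inv: "?v \<otimes> (r \<ominus> g) = \<one>" .
    then have "(r \<ominus> g) \<otimes> ?v = \<one>" using r a(1) b(1) gc(1) by (simp add: m_comm)
    with inv have "r \<ominus> g \<in> Units R"
      unfolding Units_def using r a(1) b(1) gc(1) by auto
    moreover have "r = (r \<ominus> g) \<oplus> g" using r gc(1) by algebra
    ultimately show "\<exists>u\<in>Units R. \<exists>e. idem_elem R e \<and> r = u \<oplus> e" using g(1) by blast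
  qed
qed

text \<open>The lift of \<open>r\<close> is the complement \<open>1 - g\<close>: splitting along \<open>g\<close> gives
\<open>r - (1 - g) = r g + (r - 1) (1 - g)\<close>, and both summands are multiples of \<open>r (r - 1)\<close>.\<close>

lemma (in cring) exchange_ring_imp_idempotents_lift:
  assumes ex: "exchange_ring R" and I: "ideal I R"
  shows "idempotents_lift_modulo R I"
  unfolding idempotents_lift_modulo_def
proof (intro ballI impI)
  interpret I: ideal I R by fact
  fix r assume r: "r \<in> carrier R" and rI: "r \<ominus> r \<otimes> r \<in> I"
  from ex r obtain g where g: "idem_elem R g" "g \<in> PIdl (r \<ominus> \<one>)" "\<one> \<ominus> g \<in> PIdl r"
    unfolding exchange_ring_def by blast
  then obtain a b where a: "a \<in> carrier R" "g = a \<otimes> (r \<ominus> \<one>)"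
    and b: "b \<in> carrier R" "\<one> \<ominus> g = b \<otimes> r"
    unfolding cgenideal_def by blast
  have gc: "g \<in> carrier R" using g(1) by (auto simp: idem_elem_def)
  have "r \<ominus> (\<one> \<ominus> g) = r \<otimes> g \<oplus> (r \<ominus> \<one>) \<otimes> (\<one> \<ominus> g)"
    using r gc by algebra
  also have "\<dots> = r \<otimes> (a \<otimes> (r \<ominus> \<one>)) \<oplus> (r \<ominus> \<one>) \<otimes> (b \<otimes> r)"
    using a(2) b(2) by simp
  also have "\<dots> = (\<ominus> (a \<oplus> b)) \<otimes> (r \<ominus> r \<otimes> r)" using r a(1) b(1) by algebra
  also have "\<dots> \<in> I" using rI a(1) b(1) by (simp add: I.I_l_closed)
  finally show "\<exists>e. idem_elem R e \<and> r \<ominus> e \<in> I" using idem_elem_compl[OF g(1)] by blast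
qed

lemma (in cring) comaximal_elements:
  assumes m: "maximalideal m R" and m': "maximalideal m' R" and ne: "m \<noteq> m'"
  obtains a b where "a \<in> m" "b \<in> m'" "a \<oplus> b = \<one>"
proof -
  interpret m: maximalideal m R by fact
  interpret m': maximalideal m' R by fact
  have S: "ideal (m <+> m') R" by (rule add_ideals[OF m.is_ideal m'.is_ideal])
  have 1: "m \<subseteq> m <+> m'"
  proof
    fix x assume x: "x \<in> m"
    then have "x = x \<oplus> \<zero>" by simp
    then show "x \<in> m <+> m'" using x m'.zero_closed unfolding set_add_def' by blast
  qed
  have 2: "m' \<subseteq> m <+> m'"
  proof
    fix x assume x: "x \<in> m'"
    then have "x = \<zero> \<oplus> x" by simp
    then show "x \<in> m <+> m'" using x m.zero_closed unfolding set_add_def' by blast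
  qed
  have "m <+> m' = carrier R"
    using m.I_maximal[OF S 1] m'.I_maximal[OF S 2] ne
      additive_subgroup.a_subset[OF ideal.axioms(1)[OF S]] by blast
  then have "\<one> \<in> m <+> m'" by simp
  then show thesis using that unfolding set_add_def' by auto
qed

text \<open>The element to lift is the solution \<open>a\<close> of \<open>a \<equiv> 0\<close> modulo \<open>m\<close> and \<open>a \<equiv> 1\<close> modulo \<open>m'\<close>,
which is idempotent modulo the intersection.\<close>

lemma (in cring) lifting_imp_idempotents_separate:
  assumes m: "maximalideal m R" and m': "maximalideal m' R" and ne: "m \<noteq> m'"
    and lift: "idempotents_lift_modulo R (m \<inter> m')"
  shows "\<exists>e. idem_elem R e \<and> e \<in> m \<and> \<one> \<ominus> e \<in> m'"
proof -
  interpret m: maximalideal m R by fact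
  interpret m': maximalideal m' R by fact
  obtain a b where a: "a \<in> m" and b: "b \<in> m'" and ab: "a \<oplus> b = \<one>"
    using comaximal_elements[OF m m' ne] .
  have c: "a \<in> carrier R" "b \<in> carrier R" using a b by auto
  have "a \<ominus> a \<otimes> a = a \<otimes> (a \<oplus> b) \<ominus> a \<otimes> a" using c ab by simp
  also have "\<dots> = a \<otimes> b" using c by algebra
  finally have "a \<ominus> a \<otimes> a \<in> m \<inter> m'" using a b c by (simp add: m.I_r_closed m'.I_l_closed)
  then obtain e where e: "idem_elem R e" "a \<ominus> e \<in> m" "a \<ominus> e \<in> m'"
    using lift c unfolding idempotents_lift_modulo_def by blast
  have ec: "e \<in> carrier R" using e(1) by (simp add: idem_elem_def)
  have "a \<oplus> \<ominus> (a \<ominus> e) \<in> m" using a e(2) by simp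
  moreover have "a \<oplus> \<ominus> (a \<ominus> e) = e" using ec c by algebra
  moreover have "b \<oplus> (a \<ominus> e) \<in> m'" using b e(3) by simp
  moreover have "b \<oplus> (a \<ominus> e) = (a \<oplus> b) \<ominus> e" using ec c by algebra
  ultimately show ?thesis using e(1) ab by auto
qed

section \<open>Strongly CS modules over exchange rings\<close>

lemma (in module) zero_in_submodule:
  assumes "submodule N R M"
  shows "\<zero>\<^bsub>M\<^esub> \<in> N"
  using subgroup.one_closed[OF submodule.axioms(1)[OF assms]] by simp

lemma (in module) submodule_smult_image:
  assumes a: "a \<in> carrier R" and K: "submodule K R M"
  shows "submodule ((\<lambda>x. a \<odot>\<^bsub>M\<^esub> x) ` K) R M"
proof (rule submoduleI)
  note KE = submoduleE[OF K]
  note z = zero_in_submodule[OF K]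
  show "(\<lambda>x. a \<odot>\<^bsub>M\<^esub> x) ` K \<subseteq> carrier M" using a KE(1) by auto
  show "\<zero>\<^bsub>M\<^esub> \<in> (\<lambda>x. a \<odot>\<^bsub>M\<^esub> x) ` K" using z a by (force intro: image_eqI[of _ _ "\<zero>\<^bsub>M\<^esub>"])
  show "\<ominus>\<^bsub>M\<^esub> y \<in> (\<lambda>x. a \<odot>\<^bsub>M\<^esub> x) ` K" if y: "y \<in> (\<lambda>x. a \<odot>\<^bsub>M\<^esub> x) ` K" for y
  proof -
    from y obtain x where x: "x \<in> K" "y = a \<odot>\<^bsub>M\<^esub> x" by blast
    have "x \<in> carrier M" using x KE(1) by blast
    then have "\<ominus>\<^bsub>M\<^esub> y = a \<odot>\<^bsub>M\<^esub> (\<ominus>\<^bsub>M\<^esub> x)" using smult_r_minus[OF a] x(2) by simp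
    then show ?thesis using KE(3)[OF x(1)] by blast
  qed
  show "x \<oplus>\<^bsub>M\<^esub> y \<in> (\<lambda>x. a \<odot>\<^bsub>M\<^esub> x) ` K"
    if xy: "x \<in> (\<lambda>x. a \<odot>\<^bsub>M\<^esub> x) ` K" "y \<in> (\<lambda>x. a \<odot>\<^bsub>M\<^esub> x) ` K" for x y
  proof -
    from xy obtain x' y' where x: "x' \<in> K" "y' \<in> K" "x = a \<odot>\<^bsub>M\<^esub> x'" "y = a \<odot>\<^bsub>M\<^esub> y'" by blast
    have "x' \<in> carrier M" "y' \<in> carrier M" using x KE(1) by auto
    then have "x \<oplus>\<^bsub>M\<^esub> y = a \<odot>\<^bsub>M\<^esub> (x' \<oplus>\<^bsub>M\<^esub> y')" using a x by (simp add: smult_r_distr)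
    then show ?thesis using KE(5)[OF x(1,2)] by blast
  qed
  show "r \<odot>\<^bsub>M\<^esub> y \<in> (\<lambda>x. a \<odot>\<^bsub>M\<^esub> x) ` K"
    if r: "r \<in> carrier R" and y: "y \<in> (\<lambda>x. a \<odot>\<^bsub>M\<^esub> x) ` K" for r y
  proof -
    from y obtain x where x: "x \<in> K" "y = a \<odot>\<^bsub>M\<^esub> x" by blast
    have xc: "x \<in> carrier M" using x KE(1) by blast
    have "r \<odot>\<^bsub>M\<^esub> y = (r \<otimes>\<^bsub>R\<^esub> a) \<odot>\<^bsub>M\<^esub> x" using xc r a x by (simp add: smult_assoc1)
    also have "\<dots> = (a \<otimes>\<^bsub>R\<^esub> r) \<odot>\<^bsub>M\<^esub> x" using r a by (simp add: R.m_comm)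
    also have "\<dots> = a \<odot>\<^bsub>M\<^esub> (r \<odot>\<^bsub>M\<^esub> x)" using xc r a by (simp add: smult_assoc1)
    finally show ?thesis using KE(4)[OF r x(1)] by blast
  qed
qed

lemma (in module) submodule_inter:
  assumes "submodule N R M" "submodule L R M"
  shows "submodule (N \<inter> L) R M"
  using submoduleE[OF assms(1)] submoduleE[OF assms(2)]
    zero_in_submodule[OF assms(1)] zero_in_submodule[OF assms(2)]
  by (intro submoduleI) auto

lemma (in module) submodule_sum:
  assumes N: "submodule N R M" and L: "submodule L R M"
  shows "submodule (N <+>\<^bsub>M\<^esub> L) R M"
proof (rule submoduleI)
  note NE = submoduleE[OF N] and LE = submoduleE[OF L]
  show "N <+>\<^bsub>M\<^esub> L \<subseteq> carrier M" using NE(1) LE(1) unfolding set_add_def' by auto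
  have "\<zero>\<^bsub>M\<^esub> = \<zero>\<^bsub>M\<^esub> \<oplus>\<^bsub>M\<^esub> \<zero>\<^bsub>M\<^esub>" by simp
  then show "\<zero>\<^bsub>M\<^esub> \<in> N <+>\<^bsub>M\<^esub> L"
    using zero_in_submodule[OF N] zero_in_submodule[OF L] unfolding set_add_def' by blast
  show "\<ominus>\<^bsub>M\<^esub> x \<in> N <+>\<^bsub>M\<^esub> L" if x: "x \<in> N <+>\<^bsub>M\<^esub> L" for x
  proof -
    from x obtain n l where x: "n \<in> N" "l \<in> L" "x = n \<oplus>\<^bsub>M\<^esub> l" unfolding set_add_def' by blast
    then have "\<ominus>\<^bsub>M\<^esub> x = \<ominus>\<^bsub>M\<^esub> n \<oplus>\<^bsub>M\<^esub> \<ominus>\<^bsub>M\<^esub> l"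
      using NE(1) LE(1) by (auto intro!: M.minus_add)
    then show ?thesis using NE(3)[OF x(1)] LE(3)[OF x(2)] unfolding set_add_def' by blast
  qed
  show "x \<oplus>\<^bsub>M\<^esub> y \<in> N <+>\<^bsub>M\<^esub> L" if xy: "x \<in> N <+>\<^bsub>M\<^esub> L" "y \<in> N <+>\<^bsub>M\<^esub> L" for x y
  proof -
    from xy obtain n l n' l' where x: "n \<in> N" "l \<in> L" "x = n \<oplus>\<^bsub>M\<^esub> l"
      and y: "n' \<in> N" "l' \<in> L" "y = n' \<oplus>\<^bsub>M\<^esub> l'" unfolding set_add_def' by blast
    have c: "n \<in> carrier M" "l \<in> carrier M" "n' \<in> carrier M" "l' \<in> carrier M"
      using x y NE(1) LE(1) by auto
    have "x \<oplus>\<^bsub>M\<^esub> y = (n \<oplus>\<^bsub>M\<^esub> n') \<oplus>\<^bsub>M\<^esub> (l \<oplus>\<^bsub>M\<^esub> l')"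
      unfolding x(3) y(3) using c by (simp add: M.a_ac)
    then show ?thesis using NE(5)[OF x(1) y(1)] LE(5)[OF x(2) y(2)] unfolding set_add_def' by blast
  qed
  show "a \<odot>\<^bsub>M\<^esub> x \<in> N <+>\<^bsub>M\<^esub> L" if a: "a \<in> carrier R" and x: "x \<in> N <+>\<^bsub>M\<^esub> L" for a x
  proof -
    from x obtain n l where x: "n \<in> N" "l \<in> L" "x = n \<oplus>\<^bsub>M\<^esub> l" unfolding set_add_def' by blast
    then have "a \<odot>\<^bsub>M\<^esub> x = a \<odot>\<^bsub>M\<^esub> n \<oplus>\<^bsub>M\<^esub> a \<odot>\<^bsub>M\<^esub> l"
      using NE(1) LE(1) a by (auto intro!: smult_r_distr)
    then show ?thesis using NE(4)[OF a x(1)] LE(4)[OF a x(2)] unfolding set_add_def' by blast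
  qed
qed

lemma (in module) submodule_chain_Union:
  assumes "C \<noteq> {}" and chain: "subset.chain {L. submodule L R M} C"
  shows "submodule (\<Union>C) R M"
proof (rule submoduleI)
  have sub: "submodule L R M" if "L \<in> C" for L
    using that chain unfolding pred_on.chain_def by blast
  show "\<Union>C \<subseteq> carrier M" using submoduleE(1)[OF sub] by blast
  show "\<zero>\<^bsub>M\<^esub> \<in> \<Union>C" using zero_in_submodule[OF sub] assms(1) by blast
  show "\<ominus>\<^bsub>M\<^esub> x \<in> \<Union>C" if "x \<in> \<Union>C" for x using that submoduleE(3)[OF sub] by blast
  show "a \<odot>\<^bsub>M\<^esub> x \<in> \<Union>C" if "a \<in> carrier R" "x \<in> \<Union>C" for a x
    using that submoduleE(4)[OF sub] by blast
  show "x \<oplus>\<^bsub>M\<^esub> y \<in> \<Union>C" if xy: "x \<in> \<Union>C" "y \<in> \<Union>C" for x y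
  proof -
    from xy obtain K L where KL: "K \<in> C" "x \<in> K" "L \<in> C" "y \<in> L" by blast
    then have "K \<subseteq> L \<or> L \<subseteq> K" using chain unfolding pred_on.chain_def by blast
    then show ?thesis using KL submoduleE(5)[OF sub[OF KL(1)], of x y]
        submoduleE(5)[OF sub[OF KL(3)], of x y] by blast
  qed
qed

lemma (in module) exists_complement:
  assumes N: "submodule N R M"
  obtains L where "submodule L R M" "N \<inter> L = {\<zero>\<^bsub>M\<^esub>}"
    "\<And>K. submodule K R M \<Longrightarrow> N \<inter> K = {\<zero>\<^bsub>M\<^esub>} \<Longrightarrow> L \<subseteq> K \<Longrightarrow> K = L"
proof -
  let ?A = "{L. submodule L R M \<and> N \<inter> L = {\<zero>\<^bsub>M\<^esub>}}"
  have "\<exists>L\<in>?A. \<forall>K\<in>?A. L \<subseteq> K \<longrightarrow> K = L"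
  proof (rule subset_Zorn_nonempty)
    have "submodule {\<zero>\<^bsub>M\<^esub>} R M" by (rule submoduleI) auto
    then show "?A \<noteq> {}" using zero_in_submodule[OF N] by blast
    fix C assume C: "C \<noteq> {}" "subset.chain ?A C"
    have sub: "C \<subseteq> ?A" using C(2) unfolding pred_on.chain_def by blast
    have "subset.chain {L. submodule L R M} C"
      using C(2) unfolding pred_on.chain_def by blast
    from submodule_chain_Union[OF C(1) this] have "submodule (\<Union>C) R M" .
    then show "\<Union>C \<in> ?A" using sub C(1) by blast
  qed
  then obtain L where LA: "L \<in> ?A" and max: "\<forall>K\<in>?A. L \<subseteq> K \<longrightarrow> K = L" by (rule bexE)
  from LA have "submodule L R M" "N \<inter> L = {\<zero>\<^bsub>M\<^esub>}" by simp_all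
  then show thesis by (rule that) (use max in simp)+
qed

text \<open>Here \<open>g\<close> acts as a projection that fixes \<open>N\<close> and kills its complement \<open>L\<close>. If \<open>K \<subseteq> gM\<close>
meets \<open>N\<close> trivially, applying \<open>g\<close> to an element of \<open>N \<inter> (L + K)\<close> removes its \<open>L\<close>-part, so
\<open>L + K\<close> meets \<open>N\<close> trivially as well. Maximality of \<open>L\<close> then gives \<open>K \<subseteq> L\<close>, and \<open>g\<close> is both
the identity and zero on \<open>K\<close>.\<close>

lemma (in module) essential_in_idempotent_multiple:
  assumes g: "idem_elem R g" and N: "submodule N R M" and L: "submodule L R M"
    and NL: "N \<inter> L = {\<zero>\<^bsub>M\<^esub>}"
    and maxL: "\<And>K. submodule K R M \<Longrightarrow> N \<inter> K = {\<zero>\<^bsub>M\<^esub>} \<Longrightarrow> L \<subseteq> K \<Longrightarrow> K = L"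
    and gN: "\<And>x. x \<in> N \<Longrightarrow> g \<odot>\<^bsub>M\<^esub> x = x"
    and gL: "\<And>x. x \<in> L \<Longrightarrow> g \<odot>\<^bsub>M\<^esub> x = \<zero>\<^bsub>M\<^esub>"
  shows "essential_submodule R M N ((\<lambda>x. g \<odot>\<^bsub>M\<^esub> x) ` carrier M)"
  unfolding essential_submodule_def
proof (intro conjI allI impI)
  have gc: "g \<in> carrier R" "g \<otimes>\<^bsub>R\<^esub> g = g" using g by (auto simp: idem_elem_def)
  note NE = submoduleE[OF N] and LE = submoduleE[OF L]
  show "submodule N R M" by (rule N)
  show "submodule ((\<lambda>x. g \<odot>\<^bsub>M\<^esub> x) ` carrier M) R M"
    by (rule submodule_smult_image[OF gc(1) carrier_is_submodule])
  show "N \<subseteq> (\<lambda>x. g \<odot>\<^bsub>M\<^esub> x) ` carrier M"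
  proof
    fix x assume x: "x \<in> N"
    then show "x \<in> (\<lambda>x. g \<odot>\<^bsub>M\<^esub> x) ` carrier M"
      using gN[OF x] NE(1) by (intro image_eqI[of _ _ x]) auto
  qed
  fix K assume K: "submodule K R M \<and> K \<subseteq> (\<lambda>x. g \<odot>\<^bsub>M\<^esub> x) ` carrier M \<and> N \<inter> K = {\<zero>\<^bsub>M\<^esub>}"
  then have Ksub: "submodule K R M" by simp
  note KE = submoduleE[OF Ksub]
  have gK: "g \<odot>\<^bsub>M\<^esub> k = k" if "k \<in> K" for k
  proof -
    from that K obtain x where x: "x \<in> carrier M" "k = g \<odot>\<^bsub>M\<^esub> x" by blast
    then show ?thesis using smult_assoc1[OF gc(1) gc(1) x(1)] gc(2) by simp
  qed
  have "N \<inter> (L <+>\<^bsub>M\<^esub> K) = {\<zero>\<^bsub>M\<^esub>}"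
  proof (intro equalityI subsetI)
    fix n assume "n \<in> N \<inter> (L <+>\<^bsub>M\<^esub> K)"
    then obtain l k where n: "n \<in> N" "l \<in> L" "k \<in> K" "n = l \<oplus>\<^bsub>M\<^esub> k"
      unfolding set_add_def' by blast
    have c: "l \<in> carrier M" "k \<in> carrier M" using n LE(1) KE(1) by auto
    have "n = g \<odot>\<^bsub>M\<^esub> (l \<oplus>\<^bsub>M\<^esub> k)" using gN[OF n(1)] n(4) by simp
    also have "\<dots> = g \<odot>\<^bsub>M\<^esub> l \<oplus>\<^bsub>M\<^esub> g \<odot>\<^bsub>M\<^esub> k" by (rule smult_r_distr[OF gc(1) c])
    also have "\<dots> = k" using gL[OF n(2)] gK[OF n(3)] c by simp
    finally show "n \<in> {\<zero>\<^bsub>M\<^esub>}" using n(1,3) K by blast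
  next
    fix n assume "n \<in> {\<zero>\<^bsub>M\<^esub>}"
    then show "n \<in> N \<inter> (L <+>\<^bsub>M\<^esub> K)"
      using zero_in_submodule[OF N] zero_in_submodule[OF submodule_sum[OF L Ksub]] by simp
  qed
  moreover have "L \<subseteq> L <+>\<^bsub>M\<^esub> K"
  proof
    fix l assume l: "l \<in> L"
    then have "l = l \<oplus>\<^bsub>M\<^esub> \<zero>\<^bsub>M\<^esub>" using LE(1) by auto
    then show "l \<in> L <+>\<^bsub>M\<^esub> K" using l zero_in_submodule[OF Ksub] unfolding set_add_def' by blast
  qed
  ultimately have LK: "L <+>\<^bsub>M\<^esub> K = L" using maxL submodule_sum[OF L Ksub] by blast
  show "K = {\<zero>\<^bsub>M\<^esub>}"
  proof (intro equalityI subsetI)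
    fix k assume k: "k \<in> K"
    then have "k = \<zero>\<^bsub>M\<^esub> \<oplus>\<^bsub>M\<^esub> k" using KE(1) by auto
    then have "k \<in> L" using k LK zero_in_submodule[OF L] unfolding set_add_def' by blast
    then show "k \<in> {\<zero>\<^bsub>M\<^esub>}" using gL gK[OF k] by simp
  next
    fix k assume "k \<in> {\<zero>\<^bsub>M\<^esub>}"
    then show "k \<in> K" using zero_in_submodule[OF Ksub] by simp
  qed
qed

text \<open>Let \<open>L\<close> be a complement of \<open>N\<close>. The weak IN condition gives \<open>1 = a + b\<close> with \<open>a\<close> killing
\<open>N\<close> and \<open>b\<close> killing \<open>L\<close>; the exchange property applied to \<open>a\<close> replaces this decomposition of
\<open>1\<close> by an idempotent one, \<open>1 = (1 - g) + g\<close>, with \<open>1 - g \<in> Ra\<close> and \<open>g \<in> Rb\<close>.\<close>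

lemma (in module) exchange_ring_weakly_IN_imp_strongly_CS:
  assumes ex: "exchange_ring R" and wIN: "weakly_IN R M"
  shows "strongly_CS R M"
  unfolding strongly_CS_def
proof (intro allI impI)
  fix N assume N: "submodule N R M"
  obtain L where L: "submodule L R M" "N \<inter> L = {\<zero>\<^bsub>M\<^esub>}"
    and maxL: "\<And>K. submodule K R M \<Longrightarrow> N \<inter> K = {\<zero>\<^bsub>M\<^esub>} \<Longrightarrow> L \<subseteq> K \<Longrightarrow> K = L"
    by (rule exists_complement[OF N]) (rule that, simp_all)
  have "\<one>\<^bsub>R\<^esub> \<in> module_ann R M N <+>\<^bsub>R\<^esub> module_ann R M L"
    using wIN N L unfolding weakly_IN_def by simp
  then obtain a b where ann: "a \<in> module_ann R M N" "b \<in> module_ann R M L"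
    and ab: "\<one>\<^bsub>R\<^esub> = a \<oplus>\<^bsub>R\<^esub> b"
    unfolding set_add_def' by blast
  have c: "a \<in> carrier R" "b \<in> carrier R"
    and aN: "\<And>x. x \<in> N \<Longrightarrow> a \<odot>\<^bsub>M\<^esub> x = \<zero>\<^bsub>M\<^esub>" and bL: "\<And>x. x \<in> L \<Longrightarrow> b \<odot>\<^bsub>M\<^esub> x = \<zero>\<^bsub>M\<^esub>"
    using ann by (auto simp: module_ann_def)
  obtain g where g: "idem_elem R g" "g \<in> PIdl\<^bsub>R\<^esub> (a \<ominus>\<^bsub>R\<^esub> \<one>\<^bsub>R\<^esub>)" "\<one>\<^bsub>R\<^esub> \<ominus>\<^bsub>R\<^esub> g \<in> PIdl\<^bsub>R\<^esub> a"
    using ex c(1) unfolding exchange_ring_def by blast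
  have gc: "g \<in> carrier R" using g(1) by (simp add: idem_elem_def)
  obtain s t where s: "s \<in> carrier R" "g = s \<otimes>\<^bsub>R\<^esub> (a \<ominus>\<^bsub>R\<^esub> \<one>\<^bsub>R\<^esub>)"
    and t: "t \<in> carrier R" "\<one>\<^bsub>R\<^esub> \<ominus>\<^bsub>R\<^esub> g = t \<otimes>\<^bsub>R\<^esub> a"
    using g unfolding cgenideal_def by blast
  have "g = s \<otimes>\<^bsub>R\<^esub> (a \<ominus>\<^bsub>R\<^esub> (a \<oplus>\<^bsub>R\<^esub> b))" using s(2) ab by simp
  also have "\<dots> = (\<ominus>\<^bsub>R\<^esub> s) \<otimes>\<^bsub>R\<^esub> b" using s(1) c by algebra
  finally have gb: "g = (\<ominus>\<^bsub>R\<^esub> s) \<otimes>\<^bsub>R\<^esub> b" .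
  have gL: "g \<odot>\<^bsub>M\<^esub> x = \<zero>\<^bsub>M\<^esub>" if x: "x \<in> L" for x
  proof -
    have "x \<in> carrier M" using x submoduleE(1)[OF L(1)] by blast
    then show ?thesis unfolding gb using s(1) c(2) bL[OF x] by (simp add: smult_assoc1)
  qed
  have gN: "g \<odot>\<^bsub>M\<^esub> x = x" if x: "x \<in> N" for x
  proof -
    have xc: "x \<in> carrier M" using x submoduleE(1)[OF N] by blast
    have "x = (g \<oplus>\<^bsub>R\<^esub> t \<otimes>\<^bsub>R\<^esub> a) \<odot>\<^bsub>M\<^esub> x"
    proof -
      have "g \<oplus>\<^bsub>R\<^esub> (\<one>\<^bsub>R\<^esub> \<ominus>\<^bsub>R\<^esub> g) = \<one>\<^bsub>R\<^esub>" using gc by algebra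
      then show ?thesis using t(2) xc by simp
    qed
    also have "\<dots> = g \<odot>\<^bsub>M\<^esub> x \<oplus>\<^bsub>M\<^esub> t \<odot>\<^bsub>M\<^esub> (a \<odot>\<^bsub>M\<^esub> x)"
      using xc gc t(1) c(1) by (simp add: smult_l_distr smult_assoc1)
    also have "\<dots> = g \<odot>\<^bsub>M\<^esub> x" using aN[OF x] xc gc t(1) by simp
    finally show ?thesis by simp
  qed
  show "\<exists>e. idem_elem R e \<and> essential_submodule R M N ((\<lambda>x. e \<odot>\<^bsub>M\<^esub> x) ` carrier M)"
    using g(1) essential_in_idempotent_multiple[OF g(1) N L maxL gN gL] by blast
qed

text \<open>The hypothesis says that \<open>aM\<close> and \<open>bM\<close> are zero or simple. For \<open>c = a\<close> or \<open>c = b\<close>, two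
submodules that are not killed by \<open>c\<close> both contain \<open>cM\<close>; so if \<open>N \<inter> L = 0\<close>, each of \<open>a\<close> and
\<open>b\<close> annihilates \<open>N\<close> or \<open>L\<close>, and \<open>a + b = 1\<close>.\<close>

lemma (in module) weakly_IN_if_sum_of_simple:
  assumes a: "a \<in> carrier R" and b: "b \<in> carrier R" and ab: "a \<oplus>\<^bsub>R\<^esub> b = \<one>\<^bsub>R\<^esub>"
    and simple: "\<And>c x y. c \<in> {a, b} \<Longrightarrow> x \<in> carrier M \<Longrightarrow> y \<in> carrier M \<Longrightarrow> c \<odot>\<^bsub>M\<^esub> x \<noteq> \<zero>\<^bsub>M\<^esub>
      \<Longrightarrow> \<exists>r\<in>carrier R. r \<odot>\<^bsub>M\<^esub> (c \<odot>\<^bsub>M\<^esub> x) = c \<odot>\<^bsub>M\<^esub> y"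
  shows "weakly_IN R M"
  unfolding weakly_IN_def
proof (intro allI impI)
  fix N L assume "submodule N R M \<and> submodule L R M \<and> N \<inter> L = {\<zero>\<^bsub>M\<^esub>}"
  then have N: "submodule N R M" and L: "submodule L R M" and NL: "N \<inter> L = {\<zero>\<^bsub>M\<^esub>}" by auto
  note NE = submoduleE[OF N] and LE = submoduleE[OF L]
  let ?AN = "module_ann R M N" and ?AL = "module_ann R M L"
  have kill: "c \<in> ?AN \<or> c \<in> ?AL" if c: "c \<in> {a, b}" for c
  proof (rule ccontr)
    have cc: "c \<in> carrier R" using c a b by auto
    assume "\<not> (c \<in> ?AN \<or> c \<in> ?AL)"
    then obtain x y where x: "x \<in> N" "c \<odot>\<^bsub>M\<^esub> x \<noteq> \<zero>\<^bsub>M\<^esub>" and y: "y \<in> L" "c \<odot>\<^bsub>M\<^esub> y \<noteq> \<zero>\<^bsub>M\<^esub>"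
      using cc unfolding module_ann_def by blast
    then obtain r where r: "r \<in> carrier R" "r \<odot>\<^bsub>M\<^esub> (c \<odot>\<^bsub>M\<^esub> x) = c \<odot>\<^bsub>M\<^esub> y"
      using simple[OF c _ _ x(2)] NE(1) LE(1) by blast
    then have "c \<odot>\<^bsub>M\<^esub> y \<in> N" using NE(4)[OF r(1) NE(4)[OF cc x(1)]] by simp
    then have "c \<odot>\<^bsub>M\<^esub> y \<in> N \<inter> L" using LE(4)[OF cc y(1)] by simp
    then show False using NL y(2) by blast
  qed
  have closed: "r \<otimes>\<^bsub>R\<^esub> c \<in> module_ann R M K"
    if "c \<in> module_ann R M K" "r \<in> carrier R" "K \<subseteq> carrier M" for c r K
    using that smult_assoc1 unfolding module_ann_def by (auto simp: subset_iff)
  have zero: "\<zero>\<^bsub>R\<^esub> \<in> module_ann R M K" if "K \<subseteq> carrier M" for K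
    using that unfolding module_ann_def by auto
  have add: "c \<oplus>\<^bsub>R\<^esub> d \<in> module_ann R M K"
    if "c \<in> module_ann R M K" "d \<in> module_ann R M K" "K \<subseteq> carrier M" for c d K
    using that unfolding module_ann_def by (auto simp: subset_iff smult_l_distr)
  show "?AN <+>\<^bsub>R\<^esub> ?AL = carrier R"
  proof (intro equalityI subsetI)
    fix r assume "r \<in> ?AN <+>\<^bsub>R\<^esub> ?AL"
    then show "r \<in> carrier R" unfolding set_add_def' module_ann_def by auto
  next
    fix r assume r: "r \<in> carrier R"
    have "r = r \<otimes>\<^bsub>R\<^esub> (a \<oplus>\<^bsub>R\<^esub> b)" using r ab by simp
    then have rr: "r = r \<otimes>\<^bsub>R\<^esub> a \<oplus>\<^bsub>R\<^esub> r \<otimes>\<^bsub>R\<^esub> b" using r a b by (simp add: R.r_distr)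
    have rr': "r = r \<otimes>\<^bsub>R\<^esub> b \<oplus>\<^bsub>R\<^esub> r \<otimes>\<^bsub>R\<^esub> a" using rr r a b by (simp add: R.a_comm)
    have r0: "r = \<zero>\<^bsub>R\<^esub> \<oplus>\<^bsub>R\<^esub> r" "r = r \<oplus>\<^bsub>R\<^esub> \<zero>\<^bsub>R\<^esub>" using r by auto
    consider "a \<in> ?AN" "b \<in> ?AN" | "a \<in> ?AN" "b \<in> ?AL" | "a \<in> ?AL" "b \<in> ?AN" | "a \<in> ?AL" "b \<in> ?AL"
      using kill by blast
    then show "r \<in> ?AN <+>\<^bsub>R\<^esub> ?AL"
    proof cases
      case 1
      then have "r \<in> ?AN" using rr add closed r NE(1) by metis
      then show ?thesis using r0(2) zero[OF LE(1)] unfolding set_add_def' by blast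
    next
      case 2
      then show ?thesis using rr closed[OF _ r] NE(1) LE(1) unfolding set_add_def' by blast
    next
      case 3
      then show ?thesis using rr' closed[OF _ r] NE(1) LE(1) unfolding set_add_def' by blast
    next
      case 4
      then have "r \<in> ?AL" using rr add closed r LE(1) by metis
      then show ?thesis using r0(1) zero[OF NE(1)] unfolding set_add_def' by blast
    qed
  qed
qed

section \<open>Sums of two simple modules\<close>

lemma (in ideal) quotient_module_carrier:
  "carrier (quotient_module R I) = (\<lambda>r. I +> r) ` carrier R"
  unfolding quotient_module_def FactRing_def A_RCOSETS_def' by auto

lemma (in ideal) quotient_module_zero: "\<zero>\<^bsub>quotient_module R I\<^esub> = I"
  by (simp add: quotient_module_def FactRing_def)

lemma (in ideal) quotient_module_smult:
  assumes "r \<in> carrier R" "s \<in> carrier R"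
  shows "r \<odot>\<^bsub>quotient_module R I\<^esub> (I +> s) = I +> (r \<otimes> s)"
  using rcoset_mult_add[OF assms] by (simp add: quotient_module_def FactRing_def)

lemma (in ideal) quotient_module_zero_iff:
  assumes "r \<in> carrier R"
  shows "I +> r = \<zero>\<^bsub>quotient_module R I\<^esub> \<longleftrightarrow> r \<in> I"
  using a_rcos_zero[OF is_ideal] rcos_const_imp_mem[OF assms] quotient_module_zero by auto

lemma (in cring) quotient_module_killed:
  assumes m: "ideal m R" and a: "a \<in> m" and x: "x \<in> carrier (quotient_module R m)"
  shows "a \<odot>\<^bsub>quotient_module R m\<^esub> x = \<zero>\<^bsub>quotient_module R m\<^esub>"
proof -
  interpret m: ideal m R by fact
  obtain s where s: "s \<in> carrier R" "x = m +> s" using x m.quotient_module_carrier by auto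
  show ?thesis unfolding s(2)
    using m.quotient_module_smult[OF m.Icarr[OF a] s(1)]
      m.quotient_module_zero_iff[of "a \<otimes> s"] m.I_r_closed[OF a s(1)] m.Icarr[OF a] s(1) by simp
qed

lemma (in cring) quotient_module_simple:
  assumes m: "maximalideal m R"
    and x: "x \<in> carrier (quotient_module R m)" "x \<noteq> \<zero>\<^bsub>quotient_module R m\<^esub>"
    and y: "y \<in> carrier (quotient_module R m)"
  shows "\<exists>r\<in>carrier R. r \<odot>\<^bsub>quotient_module R m\<^esub> x = y"
proof -
  interpret m: maximalideal m R by fact
  interpret Q: field "R Quot m" using m.quotient_is_field[OF is_cring] .
  have xQ: "x \<in> carrier (R Quot m)" "x \<noteq> \<zero>\<^bsub>R Quot m\<^esub>" and yQ: "y \<in> carrier (R Quot m)"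
    using x y by (simp_all add: quotient_module_def)
  have u: "x \<in> Units (R Quot m)" using xQ Q.field_Units by simp
  let ?z = "y \<otimes>\<^bsub>R Quot m\<^esub> inv\<^bsub>R Quot m\<^esub> x"
  have z: "?z \<in> carrier (R Quot m)" using u yQ by simp
  have "?z \<otimes>\<^bsub>R Quot m\<^esub> x = y"
    using u yQ xQ by (simp add: Q.m_assoc Q.Units_l_inv)
  moreover from z have "?z \<in> carrier (quotient_module R m)" by (simp add: quotient_module_def)
  then obtain r where r: "r \<in> carrier R" "?z = m +> r"
    unfolding m.quotient_module_carrier by blast
  ultimately show ?thesis by (auto simp: quotient_module_def)
qed

lemma direct_sum_sel:
  "carrier (module_direct_sum A B) = carrier A \<times> carrier B"
  "\<zero>\<^bsub>module_direct_sum A B\<^esub> = (\<zero>\<^bsub>A\<^esub>, \<zero>\<^bsub>B\<^esub>)"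
  "r \<odot>\<^bsub>module_direct_sum A B\<^esub> (x, y) = (r \<odot>\<^bsub>A\<^esub> x, r \<odot>\<^bsub>B\<^esub> y)"
  "(x, y) \<oplus>\<^bsub>module_direct_sum A B\<^esub> (x', y') = (x \<oplus>\<^bsub>A\<^esub> x', y \<oplus>\<^bsub>B\<^esub> y')"
  by (simp_all add: module_direct_sum_def)

text \<open>With \<open>1 = a + b\<close>, \<open>a \<in> m\<close>, \<open>b \<in> m'\<close>, multiplication by \<open>a\<close> kills the first summand and
multiplication by \<open>b\<close> the second, so what remains lies in a simple module.\<close>

lemma (in cring) quotient_sum_weakly_IN:
  assumes m: "maximalideal m R" and m': "maximalideal m' R" and ne: "m \<noteq> m'"
  shows "weakly_IN R (module_direct_sum (quotient_module R m) (quotient_module R m'))"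
proof -
  let ?A = "quotient_module R m" and ?B = "quotient_module R m'"
  interpret m: maximalideal m R by fact
  interpret m': maximalideal m' R by fact
  interpret A: module R ?A by (rule quotient_module_is_module[OF is_cring m.is_ideal])
  interpret B: module R ?B by (rule quotient_module_is_module[OF is_cring m'.is_ideal])
  interpret M: module R "module_direct_sum ?A ?B"
    by (rule module_direct_sum_is_module[OF A.module_axioms B.module_axioms])
  obtain a b where a: "a \<in> m" and b: "b \<in> m'" and ab: "a \<oplus> b = \<one>"
    using comaximal_elements[OF m m' ne] .
  have c: "a \<in> carrier R" "b \<in> carrier R" using a b by auto
  show ?thesis
  proof (rule M.weakly_IN_if_sum_of_simple[OF c ab])
    fix c x y assume cab: "c \<in> {a, b}"
      and x: "x \<in> carrier (module_direct_sum ?A ?B)" and y: "y \<in> carrier (module_direct_sum ?A ?B)"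
      and nz: "c \<odot>\<^bsub>module_direct_sum ?A ?B\<^esub> x \<noteq> \<zero>\<^bsub>module_direct_sum ?A ?B\<^esub>"
    obtain x1 x2 y1 y2 where xy: "x = (x1, x2)" "y = (y1, y2)" by (cases x, cases y) auto
    have xc: "x1 \<in> carrier ?A" "x2 \<in> carrier ?B" "y1 \<in> carrier ?A" "y2 \<in> carrier ?B"
      using x y by (auto simp: xy direct_sum_sel)
    show "\<exists>r\<in>carrier R. r \<odot>\<^bsub>module_direct_sum ?A ?B\<^esub> (c \<odot>\<^bsub>module_direct_sum ?A ?B\<^esub> x)
        = c \<odot>\<^bsub>module_direct_sum ?A ?B\<^esub> y"
    proof (cases "c = a")
      case True
      have k: "a \<odot>\<^bsub>?A\<^esub> x1 = \<zero>\<^bsub>?A\<^esub>" "a \<odot>\<^bsub>?A\<^esub> y1 = \<zero>\<^bsub>?A\<^esub>"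
        using quotient_module_killed[OF m.is_ideal a] xc by auto
      have "a \<odot>\<^bsub>?B\<^esub> x2 \<noteq> \<zero>\<^bsub>?B\<^esub>" using nz k True by (simp add: xy direct_sum_sel)
      then obtain r where "r \<in> carrier R" "r \<odot>\<^bsub>?B\<^esub> (a \<odot>\<^bsub>?B\<^esub> x2) = a \<odot>\<^bsub>?B\<^esub> y2"
        using quotient_module_simple[OF m', of "a \<odot>\<^bsub>?B\<^esub> x2" "a \<odot>\<^bsub>?B\<^esub> y2"] c xc by auto
      then show ?thesis using True k by (auto simp: xy direct_sum_sel)
    next
      case False
      then have cb: "c = b" using cab by simp
      have k: "b \<odot>\<^bsub>?B\<^esub> x2 = \<zero>\<^bsub>?B\<^esub>" "b \<odot>\<^bsub>?B\<^esub> y2 = \<zero>\<^bsub>?B\<^esub>"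
        using quotient_module_killed[OF m'.is_ideal b] xc by auto
      have "b \<odot>\<^bsub>?A\<^esub> x1 \<noteq> \<zero>\<^bsub>?A\<^esub>" using nz k cb by (simp add: xy direct_sum_sel)
      then obtain r where "r \<in> carrier R" "r \<odot>\<^bsub>?A\<^esub> (b \<odot>\<^bsub>?A\<^esub> x1) = b \<odot>\<^bsub>?A\<^esub> y1"
        using quotient_module_simple[OF m, of "b \<odot>\<^bsub>?A\<^esub> x1" "b \<odot>\<^bsub>?A\<^esub> y1"] c xc by auto
      then show ?thesis using cb k by (auto simp: xy direct_sum_sel)
    qed
  qed
qed

lemma direct_sum_uminus:
  assumes A: "module R A" and B: "module R B" and x: "x \<in> carrier A" and y: "y \<in> carrier B"
  shows "\<ominus>\<^bsub>module_direct_sum A B\<^esub> (x, y) = (\<ominus>\<^bsub>A\<^esub> x, \<ominus>\<^bsub>B\<^esub> y)"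
proof -
  interpret A: module R A by fact
  interpret B: module R B by fact
  interpret M: module R "module_direct_sum A B"
    by (rule module_direct_sum_is_module[OF A B])
  show ?thesis
    by (rule M.minus_equality) (simp_all add: direct_sum_sel x y A.l_neg B.l_neg)
qed

lemma direct_sum_factors_are_submodules:
  assumes A: "module R A" and B: "module R B"
  shows "submodule (carrier A \<times> {\<zero>\<^bsub>B\<^esub>}) R (module_direct_sum A B)"
    and "submodule ({\<zero>\<^bsub>A\<^esub>} \<times> carrier B) R (module_direct_sum A B)"
proof -
  interpret A: module R A by fact
  interpret B: module R B by fact
  interpret M: module R "module_direct_sum A B"
    by (rule module_direct_sum_is_module[OF A B])
  show "submodule (carrier A \<times> {\<zero>\<^bsub>B\<^esub>}) R (module_direct_sum A B)"
    by (rule M.submoduleI) (auto simp: direct_sum_sel direct_sum_uminus[OF A B])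
  show "submodule ({\<zero>\<^bsub>A\<^esub>} \<times> carrier B) R (module_direct_sum A B)"
    by (rule M.submoduleI) (auto simp: direct_sum_sel direct_sum_uminus[OF A B])
qed

text \<open>Take \<open>N = R/m \<oplus> 0\<close> essential in \<open>eM\<close>. Since \<open>e\<close> fixes the generator of \<open>N\<close>, \<open>1 - e \<in> m\<close>.
The part of \<open>eM\<close> in \<open>0 \<oplus> R/m'\<close> meets \<open>N\<close> trivially, so it is zero by essentiality; it
contains \<open>e\<close> times the generator of \<open>0 \<oplus> R/m'\<close>, so \<open>e \<in> m'\<close>. The separating idempotent is
therefore \<open>1 - e\<close>.\<close>

lemma (in cring) quotient_sum_strongly_CS_imp_idempotents_separate:
  assumes m: "maximalideal m R" and m': "maximalideal m' R"
    and CS: "strongly_CS R (module_direct_sum (quotient_module R m) (quotient_module R m'))"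
  shows "\<exists>e. idem_elem R e \<and> e \<in> m \<and> \<one> \<ominus> e \<in> m'"
proof -
  let ?A = "quotient_module R m" and ?B = "quotient_module R m'"
  let ?M = "module_direct_sum ?A ?B"
  interpret m: maximalideal m R by fact
  interpret m': maximalideal m' R by fact
  interpret A: module R ?A by (rule quotient_module_is_module[OF is_cring m.is_ideal])
  interpret B: module R ?B by (rule quotient_module_is_module[OF is_cring m'.is_ideal])
  interpret M: module R ?M
    by (rule module_direct_sum_is_module[OF A.module_axioms B.module_axioms])
  note factors = direct_sum_factors_are_submodules[OF A.module_axioms B.module_axioms]
  let ?N = "carrier ?A \<times> {\<zero>\<^bsub>?B\<^esub>}"
  obtain e where e: "idem_elem R e"
    and ess: "essential_submodule R ?M ?N ((\<lambda>x. e \<odot>\<^bsub>?M\<^esub> x) ` carrier ?M)"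
    using CS[unfolded strongly_CS_def, rule_format, OF factors(1)] by (elim exE conjE) (rule that)
  have ec: "e \<in> carrier R" "e \<otimes> e = e" using e by (auto simp: idem_elem_def)
  let ?eM = "(\<lambda>x. e \<odot>\<^bsub>?M\<^esub> x) ` carrier ?M"
  have oneA: "m +> \<one> \<in> carrier ?A" and oneB: "m' +> \<one> \<in> carrier ?B"
    using m.quotient_module_carrier m'.quotient_module_carrier by auto
  have "(m +> \<one>, \<zero>\<^bsub>?B\<^esub>) \<in> ?eM"
    using ess oneA unfolding essential_submodule_def by auto
  then obtain x where xy: "x \<in> carrier ?A" "e \<odot>\<^bsub>?A\<^esub> x = m +> \<one>"
    by (auto simp: direct_sum_sel)
  have "e \<odot>\<^bsub>?A\<^esub> (m +> \<one>) = m +> \<one>"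
    using A.smult_assoc1[OF ec(1) ec(1) xy(1)] xy(2) ec(2) by simp
  then have "m +> e = m +> \<one>" using m.quotient_module_smult[OF ec(1) one_closed] ec(1) by simp
  then have 1: "\<one> \<ominus> e \<in> m"
    using quotient_eq_iff_same_a_r_cos[OF m.is_ideal one_closed ec(1)] by simp
  let ?L = "?eM \<inter> ({\<zero>\<^bsub>?A\<^esub>} \<times> carrier ?B)"
  have L: "submodule ?L R ?M"
    by (rule M.submodule_inter[OF M.submodule_smult_image[OF ec(1) M.carrier_is_submodule] factors(2)])
  have "?N \<inter> ?L \<subseteq> {\<zero>\<^bsub>?M\<^esub>}" by (auto simp: direct_sum_sel)
  then have "?N \<inter> ?L = {\<zero>\<^bsub>?M\<^esub>}"
    using M.zero_in_submodule[OF L] M.zero_in_submodule[OF factors(1)] by blast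
  moreover have "L' = {\<zero>\<^bsub>?M\<^esub>}"
    if "submodule L' R ?M" "L' \<subseteq> ?eM" "?N \<inter> L' = {\<zero>\<^bsub>?M\<^esub>}" for L'
    using ess that unfolding essential_submodule_def by simp
  ultimately have L0: "?L = {\<zero>\<^bsub>?M\<^esub>}" using L by (meson inf_le1)
  have "e \<odot>\<^bsub>?M\<^esub> (\<zero>\<^bsub>?A\<^esub>, m' +> \<one>) \<in> ?eM"
    using oneB by (intro imageI) (simp add: direct_sum_sel)
  then have "(\<zero>\<^bsub>?A\<^esub>, e \<odot>\<^bsub>?B\<^esub> (m' +> \<one>)) \<in> ?eM"
    using ec(1) by (simp add: direct_sum_sel)
  then have "(\<zero>\<^bsub>?A\<^esub>, e \<odot>\<^bsub>?B\<^esub> (m' +> \<one>)) \<in> ?L"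
    using B.smult_closed[OF ec(1) oneB] by simp
  then have "e \<odot>\<^bsub>?B\<^esub> (m' +> \<one>) = \<zero>\<^bsub>?B\<^esub>" unfolding L0 by (simp add: direct_sum_sel)
  then have 2: "e \<in> m'"
    using m'.quotient_module_smult[OF ec(1) one_closed] m'.quotient_module_zero_iff[OF ec(1)] ec(1)
    by simp
  have "\<one> \<ominus> (\<one> \<ominus> e) = e" using ec(1) by algebra
  then show ?thesis using 1 2 idem_elem_compl[OF e] by auto
qed

theorem theorem3p5:
  fixes R :: "('a, 'r) ring_scheme"
  assumes "cring R"
  shows
    "((\<forall>M :: ('a, 'a set \<times> 'a set) module.
         module R M \<and> weakly_IN R M \<longrightarrow> strongly_CS R M)
       \<longleftrightarrow> clean_ring R)
     \<and> (clean_ring R \<longrightarrow>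
         (\<forall>M :: ('a, 'b, 'm) module_scheme.
            module R M \<and> weakly_IN R M \<longrightarrow> strongly_CS R M))
     \<and> ((\<forall>m m'. maximalideal m R \<and> maximalideal m' R \<and> m \<noteq> m' \<longrightarrow>
          strongly_CS R (module_direct_sum (quotient_module R m) (quotient_module R m')))
       \<longleftrightarrow> clean_ring R)
     \<and> ((\<forall>m m'. maximalideal m R \<and> maximalideal m' R \<and> m \<noteq> m' \<longrightarrow>
          idempotents_lift_modulo R (m \<inter> m'))
       \<longleftrightarrow> clean_ring R)
     \<and> ((\<forall>I. ideal I R \<longrightarrow> idempotents_lift_modulo R I)
       \<longleftrightarrow> clean_ring R)
     \<and> ((\<forall>m m'. maximalideal m R \<and> maximalideal m' R \<and> m \<noteq> m' \<longrightarrow>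
          (\<exists>e. idem_elem R e \<and> e \<in> m \<and> \<one>\<^bsub>R\<^esub> \<ominus>\<^bsub>R\<^esub> e \<in> m'))
       \<longleftrightarrow> clean_ring R)"
    (is "(?one \<longleftrightarrow> ?clean) \<and> (?clean \<longrightarrow> ?one') \<and> (?two \<longleftrightarrow> ?clean) \<and> (?three \<longleftrightarrow> ?clean)
      \<and> (?four \<longleftrightarrow> ?clean) \<and> (?five \<longleftrightarrow> ?clean)")
proof -
  interpret cring R by fact
  have clean_one: ?one if ?clean
    using module.exchange_ring_weakly_IN_imp_strongly_CS that clean_ring_iff_exchange_ring by blast
  have clean_one': ?one' if ?clean
    using module.exchange_ring_weakly_IN_imp_strongly_CS that clean_ring_iff_exchange_ring by blast
  have clean_four: ?four if ?clean
    using exchange_ring_imp_idempotents_lift that clean_ring_iff_exchange_ring by blast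
  have four_three: ?three if four: ?four
  proof (intro allI impI)
    fix m m' assume "maximalideal m R \<and> maximalideal m' R \<and> m \<noteq> m'"
    then have "ideal (m \<inter> m') R" using maximalideal.axioms(1) i_intersect by blast
    then show "idempotents_lift_modulo R (m \<inter> m')" using four by blast
  qed
  have three_five: ?five if ?three
    using that lifting_imp_idempotents_separate by blast
  have five_clean: ?clean if ?five
    using that exchange_ring_if_idempotents_separate clean_ring_iff_exchange_ring by blast
  have one_two: ?two if one: ?one
  proof (intro allI impI)
    fix m m' assume mm: "maximalideal m R \<and> maximalideal m' R \<and> m \<noteq> m'"
    then have "ideal m R" "ideal m' R" using maximalideal.axioms(1) by auto
    then have "module R (module_direct_sum (quotient_module R m) (quotient_module R m'))"
      using module_direct_sum_is_module quotient_module_is_module[OF is_cring] by blast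
    then show "strongly_CS R (module_direct_sum (quotient_module R m) (quotient_module R m'))"
      using one quotient_sum_weakly_IN mm by blast
  qed
  have two_five: ?five if ?two
    using that quotient_sum_strongly_CS_imp_idempotents_separate by blast
  show ?thesis
  proof (intro conjI iffI impI)
    assume ?one then show ?clean by (rule five_clean[OF two_five[OF one_two]])
  next
    assume ?clean then show ?one by (rule clean_one)
  next
    assume ?clean then show ?one' by (rule clean_one')
  next
    assume ?two then show ?clean by (rule five_clean[OF two_five])
  next
    assume ?clean then show ?two by (rule one_two[OF clean_one])
  next
    assume ?three then show ?clean by (rule five_clean[OF three_five])
  next
    assume ?clean then show ?three by (rule four_three[OF clean_four])
  next
    assume ?four then show ?clean by (rule five_clean[OF three_five[OF four_three]])
  next
    assume ?clean then show ?four by (rule clean_four)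
  next
    assume ?five then show ?clean by (rule five_clean)
  next
    assume ?clean then show ?five by (rule three_five[OF four_three[OF clean_four]])
  qed
qed

end
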